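(* Let $0<q\le1$, let $\{\alpha_n\}_{n=0}^\infty$ be a bounded sequence in $\mathbb{C}$, and let $T$ be the bounded operator on $H^2(\mathbb{D})$ given by $T(f)=\sum_{n=0}^\infty\alpha_n\langle f,z^n\rangle z^n$, $f\in H^2(\mathbb{D})$. Then the following statements are equivalent: (i) The set $\mathrm{Ber}_q(T)$ is convex. (ii) The set $\mathrm{Ber}_q(T)$ is a (possibly degenerate) line-segment in $\mathbb{C}$. (iii) All $\alpha_n$, $n\ge0$, lie on a straight line in $\mathbb{C}$.
   Context: $\mathbb{D}$ is the open unit disc in $\mathbb{C}$. $H^2(\mathbb{D})$ is the Hardy space of analytic functions $f(z)=\sum_{n\ge0}a_nz^n$ on $\mathbb{D}$ with $\sum|a_n|^2<\infty$, with inner product $\langle\sum a_nz^n,\sum b_nz^n\rangle=\sum a_n\overline{b_n}$. Its reproducing kernel at $w\in\mathbb{D}$ is $k_w(z)=\frac{1}{1-\overline{w}z}$, and $\hat{k}_w=k_w/\|k_w\|$. For a bounded linear operator $T$ on $H^2(\mathbb{D})$ and $0<q\le1$, the $q$-Berezin range is $\mathrm{Ber}_q(T)=\{\langle T\hat{k}_{w_1},\hat{k}_{w_2}\rangle: w_1,w_2\in\mathbb{D},\ \langle\hat{k}_{w_1},\hat{k}_{w_2}\rangle=q\}$. A line-segment means a bounded convex nonempty subset of a straight line; it need not contain its endpoints, and a single point counts as a degenerate line-segment. *)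

theory Defs
  imports "HOL-Complex_Analysis.Complex_Analysis"
begin

definition taylor_coeff :: "(complex \<Rightarrow> complex) \<Rightarrow> nat \<Rightarrow> complex" where
  "taylor_coeff f n = (deriv ^^ n) f 0 / fact n"

text \<open>
  Elements of the Hardy space are functions on the open unit disc only. They are represented by
  total functions that vanish outside the disc, so that equality in the type is equality on the disc.
\<close>

definition hardy2_carrier :: "(complex \<Rightarrow> complex) set" where
  "hardy2_carrier = {f. f analytic_on ball 0 1 \<and> summable (\<lambda>n. (cmod (taylor_coeff f n))\<^sup>2)
     \<and> (\<forall>z. z \<notin> ball 0 1 \<longrightarrow> f z = 0)}"

lemma taylor_coeff_sums:
  assumes "f analytic_on ball 0 1" "z \<in> ball 0 1"
  shows "(\<lambda>n. taylor_coeff f n * z ^ n) sums f z"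
  using holomorphic_power_series[of f 0 1 z] assms
  by (simp add: taylor_coeff_def analytic_on_open)

lemma power_series_analytic_disc:
  assumes "\<And>z. z \<in> ball 0 1 \<Longrightarrow> (\<lambda>n. a n * z ^ n) sums f z"
  shows "f analytic_on ball 0 1"
  using power_series_analytic[of 0 1 a f] assms by simp

lemma taylor_coeff_power_series:
  assumes s: "\<And>z. z \<in> ball 0 1 \<Longrightarrow> (\<lambda>n. a n * z ^ n) sums f z"
  shows "taylor_coeff f = a"
proof
  fix n
  have "conv_radius a \<ge> 1"
  proof (rule conv_radius_geI_ex)
    fix r :: real assume "0 < r" "ereal r < 1"
    then show "\<exists>z. norm z = r \<and> summable (\<lambda>n. a n * z ^ n)"
      using s[of "of_real r"] by (intro exI[of _ "of_real r"]) (auto simp: sums_iff)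
  qed
  then have "fps_conv_radius (Abs_fps a) > 0"
    unfolding fps_conv_radius_def using less_le_trans[of "0::ereal" 1 "conv_radius a"] by simp
  moreover have "eventually (\<lambda>z. eval_fps (Abs_fps a) z = f z) (nhds 0)"
  proof -
    have "eventually (\<lambda>z. z \<in> ball 0 (1::real)) (nhds (0::complex))"
      by (intro eventually_nhds_in_open) auto
    then show ?thesis
      by eventually_elim (use s in \<open>auto simp: eval_fps_def sums_iff\<close>)
  qed
  ultimately have "f has_fps_expansion Abs_fps a"
    by (simp add: has_fps_expansion_def)
  from fps_nth_fps_expansion[OF this, of n] show "taylor_coeff f n = a n"
    by (simp add: taylor_coeff_def)
qed

lemma hardy2_carrierI:
  assumes "\<And>z. z \<in> ball 0 1 \<Longrightarrow> (\<lambda>n. a n * z ^ n) sums f z"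
    and "\<And>z. z \<notin> ball 0 1 \<Longrightarrow> f z = 0"
    and "summable (\<lambda>n. (cmod (a n))\<^sup>2)"
  shows "f \<in> hardy2_carrier"
  using assms power_series_analytic_disc[of a f] taylor_coeff_power_series[of a f]
  by (simp add: hardy2_carrier_def)

lemma l2_add:
  fixes a b :: "nat \<Rightarrow> complex"
  assumes "summable (\<lambda>n. (cmod (a n))\<^sup>2)" "summable (\<lambda>n. (cmod (b n))\<^sup>2)"
  shows "summable (\<lambda>n. (cmod (a n + b n))\<^sup>2)"
proof (rule summable_comparison_test'[where N = 0])
  show "summable (\<lambda>n. 2 * (cmod (a n))\<^sup>2 + 2 * (cmod (b n))\<^sup>2)"
    using assms by (intro summable_add summable_mult)
  fix n
  have "(cmod (a n + b n))\<^sup>2 \<le> (cmod (a n) + cmod (b n))\<^sup>2"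
    by (intro power_mono norm_triangle_ineq) auto
  also have "\<dots> \<le> 2 * (cmod (a n))\<^sup>2 + 2 * (cmod (b n))\<^sup>2"
    using sum_squares_ge_zero[of "cmod (a n) - cmod (b n)" 0]
    by (simp add: power2_eq_square algebra_simps)
  finally show "norm ((cmod (a n + b n))\<^sup>2) \<le> 2 * (cmod (a n))\<^sup>2 + 2 * (cmod (b n))\<^sup>2"
    by simp
qed

lemma l2_mult:
  fixes a :: "nat \<Rightarrow> complex"
  assumes "summable (\<lambda>n. (cmod (a n))\<^sup>2)"
  shows "summable (\<lambda>n. (cmod (c * a n))\<^sup>2)"
  using summable_mult[OF assms, of "(cmod c)\<^sup>2"] by (simp add: norm_mult power_mult_distrib)

lemma l2_product:
  fixes a b :: "nat \<Rightarrow> complex"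
  assumes "summable (\<lambda>n. (cmod (a n))\<^sup>2)" "summable (\<lambda>n. (cmod (b n))\<^sup>2)"
  shows "summable (\<lambda>n. a n * cnj (b n))"
proof (rule summable_comparison_test'[where N = 0])
  show "summable (\<lambda>n. (cmod (a n))\<^sup>2 + (cmod (b n))\<^sup>2)"
    using assms by (intro summable_add)
  fix n
  have "2 * (cmod (a n) * cmod (b n)) \<le> (cmod (a n))\<^sup>2 + (cmod (b n))\<^sup>2"
    using sum_squares_ge_zero[of "cmod (a n) - cmod (b n)" 0]
    by (simp add: power2_eq_square algebra_simps)
  moreover have "0 \<le> cmod (a n) * cmod (b n)" by simp
  ultimately show "norm (a n * cnj (b n)) \<le> (cmod (a n))\<^sup>2 + (cmod (b n))\<^sup>2"
    unfolding norm_mult complex_mod_cnj by linarith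
qed

typedef hardy2 = hardy2_carrier
  morphisms hfun Abs_hardy2
  by (rule exI[of _ "\<lambda>_. 0"], rule hardy2_carrierI[of "\<lambda>_. 0"]) auto

definition hcoeff :: "hardy2 \<Rightarrow> nat \<Rightarrow> complex" where
  "hcoeff f n = taylor_coeff (hfun f) n"

lemma summable_hcoeff: "summable (\<lambda>n. (cmod (hcoeff f n))\<^sup>2)"
  using hfun[of f] by (simp add: hardy2_carrier_def hcoeff_def)

lemma hfun_outside: "z \<notin> ball 0 1 \<Longrightarrow> hfun f z = 0"
  using hfun[of f] by (simp add: hardy2_carrier_def)

lemma hfun_sums: "z \<in> ball 0 1 \<Longrightarrow> (\<lambda>n. hcoeff f n * z ^ n) sums hfun f z"
  using hfun[of f] taylor_coeff_sums[of "hfun f" z]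
  by (simp add: hardy2_carrier_def hcoeff_def)

lemma hardy2_eqI:
  assumes "\<And>n. hcoeff f n = hcoeff g n"
  shows "f = g"
proof -
  have "hfun f z = hfun g z" for z
    using hfun_sums[of z f] hfun_sums[of z g] assms
    by (cases "z \<in> ball 0 1") (auto simp: hfun_outside sums_iff)
  then show ?thesis by (simp add: hfun_inject[symmetric] fun_eq_iff)
qed

lemma Abs_hardy2_power_series:
  assumes "\<And>z. z \<in> ball 0 1 \<Longrightarrow> (\<lambda>n. a n * z ^ n) sums f z"
    and "\<And>z. z \<notin> ball 0 1 \<Longrightarrow> f z = 0"
    and "summable (\<lambda>n. (cmod (a n))\<^sup>2)"
  shows "hfun (Abs_hardy2 f) = f" "hcoeff (Abs_hardy2 f) = a"
proof -
  show *: "hfun (Abs_hardy2 f) = f"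
    using hardy2_carrierI[of a f] assms by (simp add: Abs_hardy2_inverse)
  show "hcoeff (Abs_hardy2 f) = a"
    unfolding fun_eq_iff hcoeff_def * using taylor_coeff_power_series[of a f] assms by simp
qed

definition hinner :: "hardy2 \<Rightarrow> hardy2 \<Rightarrow> complex" where
  "hinner f g = (\<Sum>n. hcoeff f n * cnj (hcoeff g n))"

lemma hinner_sums: "(\<lambda>n. hcoeff f n * cnj (hcoeff g n)) sums hinner f g"
  unfolding hinner_def by (intro summable_sums l2_product summable_hcoeff)

definition hscale :: "complex \<Rightarrow> hardy2 \<Rightarrow> hardy2"  (infixr \<open>*\<^sub>C\<close> 75) where
  "c *\<^sub>C f = Abs_hardy2 (\<lambda>z. c * hfun f z)"

lemma
  shows hfun_hscale: "hfun (c *\<^sub>C f) z = c * hfun f z"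
    and hcoeff_hscale: "hcoeff (c *\<^sub>C f) n = c * hcoeff f n"
proof -
  have *: "(\<lambda>n. (c * hcoeff f n) * z ^ n) sums (c * hfun f z)" if "z \<in> ball 0 1" for z
    using sums_mult[OF hfun_sums[OF that], of c] by (simp add: mult.assoc)
  note A = Abs_hardy2_power_series[of "\<lambda>n. c * hcoeff f n" "\<lambda>z. c * hfun f z",
      OF * _ l2_mult[OF summable_hcoeff], folded hscale_def]
  show "hfun (c *\<^sub>C f) z = c * hfun f z" "hcoeff (c *\<^sub>C f) n = c * hcoeff f n"
    using A by (auto simp: hfun_outside)
qed

text \<open>
  The real structure below is the underlying real Hilbert space structure: the real inner product
  is the real part of the complex one, so norm and topology are those of the complex inner product.
\<close>

instantiation hardy2 :: real_inner
begin

definition zero_hardy2_def: "0 = Abs_hardy2 (\<lambda>_. 0)"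
definition plus_hardy2_def: "f + g = Abs_hardy2 (\<lambda>z. hfun f z + hfun g z)"
definition uminus_hardy2_def: "- f = (-1) *\<^sub>C f"
definition minus_hardy2_def: "f - g = f + - (g::hardy2)"
definition scaleR_hardy2_def: "r *\<^sub>R f = complex_of_real r *\<^sub>C f"
definition inner_hardy2_def: "inner f g = Re (hinner f g)"
definition norm_hardy2_def: "norm f = sqrt (inner f (f::hardy2))"
definition sgn_hardy2_def: "sgn f = inverse (norm f) *\<^sub>R (f::hardy2)"
definition dist_hardy2_def: "dist f g = norm (f - (g::hardy2))"
definition uniformity_hardy2_def:
  "(uniformity :: (hardy2 \<times> hardy2) filter) = (INF e\<in>{0<..}. principal {(x, y). dist x y < e})"
definition open_hardy2_def:
  "open (U :: hardy2 set) = (\<forall>x\<in>U. eventually (\<lambda>(x', y). x' = x \<longrightarrow> y \<in> U) uniformity)"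

lemma hcoeff_zero: "hcoeff 0 n = 0"
  unfolding zero_hardy2_def using Abs_hardy2_power_series[of "\<lambda>_. 0" "\<lambda>_. 0"] by simp

lemma hfun_plus: "hfun (f + g) z = hfun f z + hfun g z"
  and hcoeff_plus: "hcoeff (f + g) n = hcoeff f n + hcoeff g n"
proof -
  have *: "(\<lambda>n. (hcoeff f n + hcoeff g n) * z ^ n) sums (hfun f z + hfun g z)"
    if "z \<in> ball 0 1" for z
    using sums_add[OF hfun_sums[OF that, of f] hfun_sums[OF that, of g]]
    by (simp add: distrib_right)
  note A = Abs_hardy2_power_series[of "\<lambda>n. hcoeff f n + hcoeff g n" "\<lambda>z. hfun f z + hfun g z",
      OF * _ l2_add[OF summable_hcoeff summable_hcoeff], folded plus_hardy2_def]
  show "hfun (f + g) z = hfun f z + hfun g z" "hcoeff (f + g) n = hcoeff f n + hcoeff g n"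
    using A by (auto simp: hfun_outside)
qed

lemmas hcoeff_simps = hcoeff_zero hcoeff_plus hcoeff_hscale uminus_hardy2_def scaleR_hardy2_def

lemma hinner_self_sums: "(\<lambda>n. (cmod (hcoeff f n))\<^sup>2) sums Re (hinner f f)"
  using sums_Re[OF hinner_sums[of f f]] unfolding cmod_power2
  by (simp add: power2_eq_square)

instance
proof
  fix f g h :: hardy2 and r s :: real
  show "f + g + h = f + (g + h)"
    by (rule hardy2_eqI) (simp add: hcoeff_simps algebra_simps)
  show "f + g = g + f"
    by (rule hardy2_eqI) (simp add: hcoeff_simps algebra_simps)
  show "0 + f = f"
    by (rule hardy2_eqI) (simp add: hcoeff_simps algebra_simps)
  show "- f + f = 0"
    by (rule hardy2_eqI) (simp add: hcoeff_simps algebra_simps)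
  show "f - g = f + - g" by (rule minus_hardy2_def)
  show "r *\<^sub>R (f + g) = r *\<^sub>R f + r *\<^sub>R g"
    by (rule hardy2_eqI) (simp add: hcoeff_simps algebra_simps)
  show "(r + s) *\<^sub>R f = r *\<^sub>R f + s *\<^sub>R f"
    by (rule hardy2_eqI) (simp add: hcoeff_simps algebra_simps)
  show "r *\<^sub>R s *\<^sub>R f = (r * s) *\<^sub>R f"
    by (rule hardy2_eqI) (simp add: hcoeff_simps algebra_simps)
  show "1 *\<^sub>R f = f"
    by (rule hardy2_eqI) (simp add: hcoeff_simps algebra_simps)
  show "sgn f = inverse (norm f) *\<^sub>R f" by (rule sgn_hardy2_def)
  show "dist f g = norm (f - g)" by (rule dist_hardy2_def)
  show "(uniformity :: (hardy2 \<times> hardy2) filter) = (INF e\<in>{0<..}. principal {(x, y). dist x y < e})"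
    by (rule uniformity_hardy2_def)
  show "open U = (\<forall>x\<in>U. eventually (\<lambda>(x', y). x' = x \<longrightarrow> y \<in> U) uniformity)" for U :: "hardy2 set"
    by (rule open_hardy2_def)
  have "(\<lambda>n. cnj (hcoeff g n * cnj (hcoeff f n))) sums cnj (hinner g f)"
    using hinner_sums[of g f] by (simp only: sums_cnj)
  then have "hinner f g = cnj (hinner g f)"
    unfolding hinner_def[of f g] by (simp add: sums_iff mult.commute)
  then show "inner f g = inner g f" by (simp add: inner_hardy2_def)
  have "hinner (f + g) h = hinner f h + hinner g h"
    using sums_add[OF hinner_sums[of f h] hinner_sums[of g h]]
    unfolding hinner_def[of "f + g"] by (simp add: hcoeff_plus distrib_right sums_iff)
  then show "inner (f + g) h = inner f h + inner g h" by (simp add: inner_hardy2_def)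
  have "hinner (r *\<^sub>R f) g = r * hinner f g"
    using sums_mult[OF hinner_sums[of f g], of "of_real r"]
    unfolding hinner_def[of "r *\<^sub>R f"]
    by (simp add: hcoeff_hscale scaleR_hardy2_def mult.assoc sums_iff)
  then show "inner (r *\<^sub>R f) g = r * inner f g" by (simp add: inner_hardy2_def)
  note S = hinner_self_sums[of f]
  show "0 \<le> inner f f"
    unfolding inner_hardy2_def by (rule sums_le[OF _ sums_zero S]) auto
  show "inner f f = 0 \<longleftrightarrow> f = 0"
  proof
    assume "inner f f = 0"
    then have "(\<Sum>n. (cmod (hcoeff f n))\<^sup>2) = 0"
      using S by (simp add: inner_hardy2_def sums_iff)
    then have "\<forall>n. (cmod (hcoeff f n))\<^sup>2 = 0"
      using suminf_eq_zero_iff[OF summable_hcoeff[of f]] by simp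
    then show "f = 0" by (intro hardy2_eqI) (simp add: hcoeff_zero)
  next
    assume "f = 0"
    then show "inner f f = 0" by (simp add: inner_hardy2_def hinner_def hcoeff_zero)
  qed
  show "norm f = sqrt (inner f f)" by (rule norm_hardy2_def)
qed

end

lemma norm_hardy2_sums: "(\<lambda>n. (cmod (hcoeff f n))\<^sup>2) sums (norm f)\<^sup>2"
  using hinner_self_sums[of f] by (simp add: power2_norm_eq_inner inner_hardy2_def)

definition hmonom :: "nat \<Rightarrow> hardy2" where
  "hmonom n = Abs_hardy2 (\<lambda>z. if z \<in> ball 0 1 then z ^ n else 0)"

definition hkernel :: "complex \<Rightarrow> hardy2" where
  "hkernel w = Abs_hardy2 (\<lambda>z. if z \<in> ball 0 1 then 1 / (1 - cnj w * z) else 0)"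

definition hkernel_normalized :: "complex \<Rightarrow> hardy2" where
  "hkernel_normalized w = (1 / norm (hkernel w)) *\<^sub>R hkernel w"

definition Berezin_range :: "real \<Rightarrow> (hardy2 \<Rightarrow> hardy2) \<Rightarrow> complex set" where
  "Berezin_range q T =
     {hinner (T (hkernel_normalized w\<^sub>1)) (hkernel_normalized w\<^sub>2) | w\<^sub>1 w\<^sub>2.
        w\<^sub>1 \<in> ball 0 1 \<and> w\<^sub>2 \<in> ball 0 1 \<and>
        hinner (hkernel_normalized w\<^sub>1) (hkernel_normalized w\<^sub>2) = complex_of_real q}"

text \<open>Endpoints need not belong to the segment, and singletons are allowed.\<close>

definition line_segment :: "complex set \<Rightarrow> bool" where
  "line_segment S \<longleftrightarrow> S \<noteq> {} \<and> bounded S \<and> convex S \<and> collinear S"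

lemma
  shows hfun_hmonom: "hfun (hmonom n) z = (if z \<in> ball 0 1 then z ^ n else 0)"
    and hcoeff_hmonom: "hcoeff (hmonom n) k = (if k = n then 1 else 0)"
proof -
  have "(\<lambda>k. (if k = n then 1 else 0) * z ^ k) sums z ^ n" for z :: complex
    using sums_If_finite_set[of "{n}" "\<lambda>k. z ^ k"]
    by (simp add: if_distrib[of "\<lambda>c. c * _"] cong: if_cong)
  moreover have "summable (\<lambda>k. (cmod (if k = n then 1 else 0))\<^sup>2)"
    by (rule summable_finite[of "{n}"]) auto
  ultimately show "hfun (hmonom n) z = (if z \<in> ball 0 1 then z ^ n else 0)"
    "hcoeff (hmonom n) k = (if k = n then 1 else 0)"
    unfolding hmonom_def
    by (subst Abs_hardy2_power_series[where a = "\<lambda>k. if k = n then 1 else 0"]; simp)+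
qed

lemma
  assumes "w \<in> ball 0 1"
  shows hfun_hkernel: "hfun (hkernel w) z = (if z \<in> ball 0 1 then 1 / (1 - cnj w * z) else 0)"
    and hcoeff_hkernel: "hcoeff (hkernel w) n = cnj w ^ n"
proof -
  have w: "cmod w < 1" using assms by simp
  have 1: "(\<lambda>n. cnj w ^ n * z ^ n) sums (1 / (1 - cnj w * z))" if "z \<in> ball 0 1" for z
  proof -
    have "norm (cnj w * z) < 1"
      using w that mult_strict_mono'[of "cmod w" 1 "cmod z" 1] by (simp add: norm_mult)
    from geometric_sums[OF this] show ?thesis by (simp add: power_mult_distrib)
  qed
  have "(cmod w)\<^sup>2 < 1" using w by (simp add: power_less_one_iff)
  then have "summable (\<lambda>n. (cmod w ^ 2) ^ n)"
    by (intro summable_geometric) simp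
  then have 2: "summable (\<lambda>n. (cmod (cnj w ^ n))\<^sup>2)"
    by (simp add: norm_power mult.commute flip: power_mult)
  note A = Abs_hardy2_power_series[of "\<lambda>n. cnj w ^ n"
      "\<lambda>z. if z \<in> ball 0 1 then 1 / (1 - cnj w * z) else 0", folded hkernel_def]
  have "hfun (hkernel w) = (\<lambda>z. if z \<in> ball 0 1 then 1 / (1 - cnj w * z) else 0)"
    by (rule A(1)) (use 1 2 in auto)
  moreover have "hcoeff (hkernel w) = (\<lambda>n. cnj w ^ n)"
    by (rule A(2)) (use 1 2 in auto)
  ultimately show "hfun (hkernel w) z = (if z \<in> ball 0 1 then 1 / (1 - cnj w * z) else 0)"
    "hcoeff (hkernel w) n = cnj w ^ n" by simp_all
qed

lemma hkernel_reproducing: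
  assumes "w \<in> ball 0 1"
  shows "hinner f (hkernel w) = hfun f w"
  using hfun_sums[OF assms, of f] by (simp add: hinner_def hcoeff_hkernel[OF assms] sums_iff)

lemma hinner_hmonom: "hinner f (hmonom n) = hcoeff f n"
  using sums_unique[OF sums_If_finite_set[of "{n}" "\<lambda>k. hcoeff f k"]]
  by (simp add: hinner_def hcoeff_hmonom if_distrib cong: if_cong)

lemma hinner_hscale_left: "hinner (c *\<^sub>C f) g = c * hinner f g"
  using sums_mult[OF hinner_sums[of f g], of c]
  unfolding hinner_def[of "c *\<^sub>C f"] by (simp add: hcoeff_hscale mult.assoc sums_iff)

lemma hcoeff_diff: "hcoeff (f - g) n = hcoeff f n - hcoeff g n"
  unfolding minus_hardy2_def uminus_hardy2_def hcoeff_plus hcoeff_hscale by simp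

lemma hcoeff_sum: "hcoeff (sum f A) n = (\<Sum>i\<in>A. hcoeff (f i) n)"
  by (induction A rule: infinite_finite_induct) (simp_all add: hcoeff_zero hcoeff_plus)

lemma hardy2_sums_of_hcoeff:
  "(\<lambda>n. hcoeff f n *\<^sub>C hmonom n) sums f"
proof -
  let ?P = "\<lambda>N. \<Sum>n<N. hcoeff f n *\<^sub>C hmonom n"
  have c: "hcoeff (f - ?P N) n = (if n < N then 0 else hcoeff f n)" for N n
    by (simp add: hcoeff_diff hcoeff_sum hcoeff_hscale hcoeff_hmonom if_distrib cong: if_cong)
  have "(norm (f - ?P N))\<^sup>2 = (\<Sum>n. (cmod (hcoeff f (n + N)))\<^sup>2)" for N
  proof -
    have "(norm (f - ?P N))\<^sup>2 = (\<Sum>n. (cmod (hcoeff (f - ?P N) n))\<^sup>2)"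
      using norm_hardy2_sums[of "f - ?P N"] by (simp add: sums_iff)
    also have "\<dots> = (\<Sum>n. (cmod (hcoeff (f - ?P N) (n + N)))\<^sup>2)
        + (\<Sum>n<N. (cmod (hcoeff (f - ?P N) n))\<^sup>2)"
      by (rule suminf_split_initial_segment[OF summable_hcoeff])
    finally show ?thesis by (simp add: c)
  qed
  moreover have "(\<lambda>N. \<Sum>n. (cmod (hcoeff f (n + N)))\<^sup>2) \<longlonglongrightarrow> 0"
    by (rule suminf_exist_split2[OF summable_hcoeff])
  ultimately have "(\<lambda>N. (norm (f - ?P N))\<^sup>2) \<longlonglongrightarrow> 0" by simp
  then have "(\<lambda>N. sqrt ((norm (f - ?P N))\<^sup>2)) \<longlonglongrightarrow> sqrt 0"
    by (rule tendsto_real_sqrt)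
  then have "(\<lambda>N. dist (?P N) f) \<longlonglongrightarrow> 0"
    by (simp add: dist_norm norm_minus_commute)
  then show ?thesis
    unfolding sums_def by (rule tendsto_dist_iff[THEN iffD2])
qed

definition diag_op :: "(nat \<Rightarrow> complex) \<Rightarrow> hardy2 \<Rightarrow> hardy2" where
  "diag_op \<alpha> f = (\<Sum>n. (\<alpha> n * hinner f (hmonom n)) *\<^sub>C hmonom n)"

text \<open>
  For a bounded symbol the defining series converges in the norm of the Hardy space, and the
  resulting operator is complex linear and bounded.
\<close>

context
  fixes \<alpha> :: "nat \<Rightarrow> complex"
  assumes bdd: "bounded (range \<alpha>)"
begin

lemma diag_op_aux:
  obtains g where "(\<lambda>n. (\<alpha> n * hinner f (hmonom n)) *\<^sub>C hmonom n) sums g"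
    and "\<And>n. hcoeff g n = \<alpha> n * hcoeff f n"
proof -
  obtain B where B: "\<And>n. cmod (\<alpha> n) \<le> B" using bdd by (auto simp: bounded_iff)
  have l2: "summable (\<lambda>n. (cmod (\<alpha> n * hcoeff f n))\<^sup>2)"
  proof (rule summable_comparison_test'[where N = 0])
    show "summable (\<lambda>n. B\<^sup>2 * (cmod (hcoeff f n))\<^sup>2)"
      by (intro summable_mult summable_hcoeff)
    show "norm ((cmod (\<alpha> n * hcoeff f n))\<^sup>2) \<le> B\<^sup>2 * (cmod (hcoeff f n))\<^sup>2" for n
      using B[of n] by (simp add: norm_mult power_mult_distrib mult_right_mono power_mono)
  qed
  have conv: "summable (\<lambda>n. \<alpha> n * hcoeff f n * z ^ n)" if z: "z \<in> ball 0 1" for z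
  proof -
    have "(cmod z)\<^sup>2 < 1" using z by (simp add: power_less_one_iff)
    then have "summable (\<lambda>n. (cmod z ^ 2) ^ n)" by (intro summable_geometric) simp
    then have "summable (\<lambda>n. (cmod (cnj z ^ n))\<^sup>2)"
      by (simp add: norm_power mult.commute flip: power_mult)
    from l2_product[OF l2 this] show ?thesis by simp
  qed
  define F where "F = (\<lambda>z. if z \<in> ball 0 1 then \<Sum>n. \<alpha> n * hcoeff f n * z ^ n else 0)"
  define g where "g = Abs_hardy2 F"
  have "hcoeff g = (\<lambda>n. \<alpha> n * hcoeff f n)"
    unfolding g_def
    by (rule Abs_hardy2_power_series(2)) (use conv l2 in \<open>auto simp: F_def intro: summable_sums\<close>)
  then have g: "hcoeff g n = \<alpha> n * hcoeff f n" for n by simp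
  show ?thesis
    using that[of g] hardy2_sums_of_hcoeff[of g] g by (simp add: hinner_hmonom)
qed

lemma diag_op_sums: "(\<lambda>n. (\<alpha> n * hinner f (hmonom n)) *\<^sub>C hmonom n) sums diag_op \<alpha> f"
  unfolding diag_op_def by (rule diag_op_aux[of f]) (auto simp: sums_iff)

lemma hcoeff_diag_op: "hcoeff (diag_op \<alpha> f) n = \<alpha> n * hcoeff f n"
  by (rule diag_op_aux[of f]) (auto simp: diag_op_def sums_iff)

lemma diag_op_hscale: "diag_op \<alpha> (c *\<^sub>C f) = c *\<^sub>C diag_op \<alpha> f"
  by (rule hardy2_eqI) (simp add: hcoeff_diag_op hcoeff_hscale)

lemma bounded_linear_diag_op: "bounded_linear (diag_op \<alpha>)"
proof -
  obtain B where B: "\<And>n. cmod (\<alpha> n) \<le> B" using bdd by (auto simp: bounded_iff)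
  have B0: "0 \<le> B" using B[of 0] norm_ge_zero order_trans by blast
  show ?thesis
  proof (rule bounded_linear_intro[where K = B])
    fix f g :: hardy2 and r :: real
    show "diag_op \<alpha> (f + g) = diag_op \<alpha> f + diag_op \<alpha> g"
      by (rule hardy2_eqI) (simp add: hcoeff_diag_op hcoeff_plus distrib_left)
    show "diag_op \<alpha> (r *\<^sub>R f) = r *\<^sub>R diag_op \<alpha> f"
      by (simp add: scaleR_hardy2_def diag_op_hscale)
    have "(norm (diag_op \<alpha> f))\<^sup>2 \<le> B\<^sup>2 * (norm f)\<^sup>2"
    proof (rule sums_le[OF _ norm_hardy2_sums sums_mult[OF norm_hardy2_sums]])
      show "(cmod (hcoeff (diag_op \<alpha> f) n))\<^sup>2 \<le> B\<^sup>2 * (cmod (hcoeff f n))\<^sup>2" for n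
        using B[of n] by (simp add: hcoeff_diag_op norm_mult power_mult_distrib mult_right_mono power_mono)
    qed
    then show "norm (diag_op \<alpha> f) \<le> norm f * B"
      using B0 power2_le_imp_le[of "norm (diag_op \<alpha> f)" "norm f * B"]
      by (simp add: power_mult_distrib mult.commute)
  qed
qed

end

end

theory Submission
  imports Defs
begin

text \<open>
  If the normalized kernels at \<open>w\<^sub>1\<close> and \<open>w\<^sub>2\<close> have inner product \<open>q\<close>, then \<open>t = cnj w\<^sub>1 * w\<^sub>2\<close> is
  real and \<open>\<langle>T k\<^sub>1, k\<^sub>2\<rangle> = q (1 - t) (\<Sum>n. \<alpha>\<^sub>n t\<^sup>n)\<close>, where \<open>t\<close> ranges over \<open>[-(1-q)/(1+q), 1)\<close>. Hence the
  \<open>q\<close>-Berezin range is a smooth curve. It is a null set, so that if it is convex then it lies on a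
  line. By uniqueness of power series coefficients the curve lies on a line exactly when the
  \<open>\<alpha>\<^sub>n\<close> do, and a bounded connected subset of a line is a line segment.
\<close>

definition symbol_curve :: "real \<Rightarrow> (nat \<Rightarrow> complex) \<Rightarrow> complex \<Rightarrow> complex" where
  "symbol_curve q \<alpha> z = of_real q * (1 - z) * (\<Sum>n. \<alpha> n * z ^ n)"

section \<open>Lines in the plane and differentiable curves\<close>

text \<open>In the plane the hyperplanes are the lines. The form \<open>a \<bullet> x = b\<close> is
  chosen because a linear functional can be applied to a power series term by term.\<close>

lemma complex_collinear_iff:
  fixes S :: "complex set"
  shows "collinear S \<longleftrightarrow> (\<exists>a b. a \<noteq> 0 \<and> S \<subseteq> {x. a \<bullet> x = b})"
proof
  assume "collinear S"
  then have "aff_dim S < DIM(complex)" by (simp add: collinear_aff_dim)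
  then show "\<exists>a b. a \<noteq> 0 \<and> S \<subseteq> {x. a \<bullet> x = b}"
    by (rule aff_lowdim_subset_hyperplane) blast
next
  assume "\<exists>a b. a \<noteq> 0 \<and> S \<subseteq> {x. a \<bullet> x = b}"
  then obtain a b where "a \<noteq> 0" and S: "S \<subseteq> {x. a \<bullet> x = b}" by blast
  then have "collinear {x. a \<bullet> x = b}" by (simp add: collinear_aff_dim)
  then show "collinear S" using S by (rule collinear_subset)
qed

text \<open>A differentiable map from the reals to the plane has images of measure zero, hence with
  empty interior, and a convex set with empty interior lies in a hyperplane.\<close>

lemma convex_differentiable_curve_collinear:
  fixes f :: "real \<Rightarrow> complex"
  assumes "f differentiable_on S" "convex (f ` S)"
  shows "collinear (f ` S)"
proof -
  have "negligible (f ` S)"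
    by (rule negligible_differentiable_image_lowdim) (use assms in auto)
  then have "interior (f ` S) = {}"
    using open_not_negligible[OF open_interior] negligible_subset interior_subset by blast
  then show ?thesis
    unfolding complex_collinear_iff
    using empty_interior_subset_hyperplane[OF assms(2)] by metis
qed

section \<open>Power series with bounded or real coefficients\<close>

lemma summable_bounded_coeffs:
  fixes \<alpha> :: "nat \<Rightarrow> complex"
  assumes "\<And>n. cmod (\<alpha> n) \<le> B" "cmod z < 1"
  shows "summable (\<lambda>n. \<alpha> n * z ^ n)" "cmod (\<Sum>n. \<alpha> n * z ^ n) \<le> B / (1 - cmod z)"
proof -
  have g: "(\<lambda>n. B * cmod z ^ n) sums (B * (1 / (1 - cmod z)))"
    using assms(2) by (intro sums_mult geometric_sums) auto
  have le: "norm (\<alpha> n * z ^ n) \<le> B * cmod z ^ n" for n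
    using assms(1)[of n] by (simp add: norm_mult norm_power mult_right_mono)
  show "summable (\<lambda>n. \<alpha> n * z ^ n)"
    by (rule summable_comparison_test'[OF sums_summable[OF g], where N = 0]) (rule le)
  show "cmod (\<Sum>n. \<alpha> n * z ^ n) \<le> B / (1 - cmod z)"
    using norm_suminf_le[OF le sums_summable[OF g]] sums_unique[OF g] by simp
qed

text \<open>Zeros of a nonzero power series are isolated, so vanishing on one side of
  \<open>0\<close> is enough. The curve parameter may be confined to \<open>{0..<1}\<close>, as
  happens for \<open>q = 1\<close>.\<close>

lemma real_power_series_eq_zero:
  fixes c :: "nat \<Rightarrow> real"
  assumes s: "\<And>x. \<bar>x\<bar> < 1 \<Longrightarrow> summable (\<lambda>n. c n * x ^ n)"
    and z: "\<And>x. 0 \<le> x \<Longrightarrow> x < 1 \<Longrightarrow> (\<Sum>n. c n * x ^ n) = 0"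
  shows "c m = 0"
proof (rule ccontr)
  assume nz: "c m \<noteq> 0"
  have z0: "(\<Sum>n. c n * 0 ^ n) = 0" using z[of 0] by simp
  \<comment> \<open>\<open>powser_0_nonzero\<close> asks for value zero at the centre and a nonzero
    coefficient of positive index.\<close>
  then have "m > 0" using nz by (cases m) auto
  obtain e where e: "0 < e" "\<And>x. x \<in> cball 0 e - {0} \<Longrightarrow> (\<Sum>n. c n * x ^ n) \<noteq> 0"
    by (rule powser_0_nonzero[of 1 0 c "\<lambda>x. \<Sum>n. c n * x ^ n", OF _ _ z0 nz \<open>m > 0\<close>])
      (use s in \<open>auto intro!: summable_sums\<close>)
  define x where "x = min e (1/2)"
  have "0 < x" "x < 1" "x \<le> e" using e(1) by (auto simp: x_def)
  then show False using e(2)[of x] z[of x] by simp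
qed

section \<open>Admissible values of the parameter\<close>

text \<open>For \<open>0 \<le> t < 1\<close> the inequality on the right follows from
  \<open>q \<le> 1\<close>; for \<open>t < 0\<close> it is the lower bound of the interval with
  denominators cleared.\<close>

lemma Berezin_parameter_iff:
  fixes q t :: real
  assumes q: "0 < q" "q \<le> 1"
  shows "t \<in> {- ((1 - q) / (1 + q))..<1} \<longleftrightarrow> \<bar>t\<bar> < 1 \<and> q * (1 - t) \<le> 1 - \<bar>t\<bar>"
proof -
  have iff: "- ((1 - q) / (1 + q)) \<le> t \<longleftrightarrow> q * (1 - t) \<le> 1 + t"
    using q by (simp add: field_simps)
  have pos: "0 < q * (1 - t)" "q * (1 - t) \<le> 1 - t" if "t < 1"
    using q that mult_right_mono[of q 1 "1 - t"] by simp_all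
  show ?thesis
    unfolding atLeastLessThan_iff iff using pos by (auto simp: abs_if)
qed

text \<open>Every admissible \<open>t\<close> is realised by a pair of real points of the disc,
  which become \<open>w1\<close> and \<open>w2\<close>.\<close>

lemma Berezin_parameter_existence:
  fixes q t :: real
  assumes q: "0 < q" and t: "\<bar>t\<bar> < 1" "q * (1 - t) \<le> 1 - \<bar>t\<bar>"
  obtains x y where "x * y = t" "\<bar>x\<bar> < 1" "\<bar>y\<bar> < 1" "(1 - x\<^sup>2) * (1 - y\<^sup>2) = (q * (1 - t))\<^sup>2"
proof -
  define c where "c = 1 + t\<^sup>2 - (q * (1 - t))\<^sup>2"
  have "0 < q * (1 - t)" using q t(1) by simp
  then have "(q * (1 - t))\<^sup>2 \<le> (1 - \<bar>t\<bar>)\<^sup>2"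
    using t(2) by (intro power_mono) auto
  \<comment> \<open>This makes both radicands \<open>c + 2 * t\<close> and \<open>c - 2 * t\<close>
    nonnegative.\<close>
  then have c: "2 * \<bar>t\<bar> \<le> c" unfolding c_def by (simp add: power2_diff)
  \<comment> \<open>The conditions on \<open>x\<close> and \<open>y\<close> amount to \<open>x * y = t\<close> and \<open>x\<^sup>2 + y\<^sup>2 = c\<close>, so \<open>(x \<plusminus> y)\<^sup>2 = c \<plusminus> 2 t\<close>.\<close>
  define u v where "u = sqrt (c + 2 * t)" and "v = sqrt (c - 2 * t)"
  have uv: "u\<^sup>2 = c + 2 * t" "v\<^sup>2 = c - 2 * t"
    using c by (auto simp: u_def v_def)
  define x y where "x = (u + v) / 2" and "y = (u - v) / 2"
  have xy: "x * y = t"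
    using uv by (simp add: x_def y_def power2_eq_square algebra_simps)
  have "x\<^sup>2 + y\<^sup>2 = (u\<^sup>2 + v\<^sup>2) / 2"
    by (simp add: x_def y_def power2_eq_square field_simps)
  then have sq: "x\<^sup>2 + y\<^sup>2 = c" using uv by simp
  have "(1 - x\<^sup>2) * (1 - y\<^sup>2) = 1 - (x\<^sup>2 + y\<^sup>2) + (x * y)\<^sup>2"
    by (simp add: power_mult_distrib algebra_simps)
  then have p: "(1 - x\<^sup>2) * (1 - y\<^sup>2) = (q * (1 - t))\<^sup>2"
    unfolding sq xy by (simp add: c_def)
  then have pos: "0 < (1 - x\<^sup>2) * (1 - y\<^sup>2)"
    using zero_less_power[OF \<open>0 < q * (1 - t)\<close>] by (simp only:)
  \<comment> \<open>A positive product \<open>(1 - x\<^sup>2) * (1 - y\<^sup>2)\<close> could still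
    have two negative factors; \<open>\<bar>x * y\<bar> < 1\<close> excludes this.\<close>
  have "x\<^sup>2 * y\<^sup>2 < 1"
    using t(1) xy by (metis abs_square_less_1 power_mult_distrib)
  then have "\<not> (1 < x\<^sup>2 \<and> 1 < y\<^sup>2)"
    using less_1_mult[of "x\<^sup>2" "y\<^sup>2"] by linarith
  then have "x\<^sup>2 < 1" "y\<^sup>2 < 1"
    using pos by (auto simp: zero_less_mult_iff)
  then show ?thesis using that[OF xy _ _ p] by (simp add: abs_square_less_1)
qed

text \<open>Converse direction, with \<open>x\<close> and \<open>y\<close> the moduli of the two
  points: \<open>(1 - x\<^sup>2) * (1 - y\<^sup>2)\<close> falls short of
  \<open>(1 - x * y)\<^sup>2\<close> by the square \<open>(x - y)\<^sup>2\<close>.\<close>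

lemma Berezin_parameter_bound:
  fixes q t x y :: real
  assumes xy: "x \<ge> 0" "y \<ge> 0" "x < 1" "y < 1" "x * y = \<bar>t\<bar>"
    and p: "(1 - x\<^sup>2) * (1 - y\<^sup>2) = (q * (1 - t))\<^sup>2"
  shows "\<bar>t\<bar> < 1" "q * (1 - t) \<le> 1 - \<bar>t\<bar>"
proof -
  show t1: "\<bar>t\<bar> < 1"
    using mult_strict_mono'[of x 1 y 1] xy by simp
  have "(1 - x\<^sup>2) * (1 - y\<^sup>2) = (1 - x * y)\<^sup>2 - (x - y)\<^sup>2"
    by (simp add: power2_eq_square algebra_simps)
  then have "(q * (1 - t))\<^sup>2 \<le> (1 - \<bar>t\<bar>)\<^sup>2"
    using p xy(5) by simp
  then show "q * (1 - t) \<le> 1 - \<bar>t\<bar>"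
    by (rule power2_le_imp_le) (use t1 in simp)
qed

section \<open>The Berezin range as a curve\<close>

lemma hcoeff_hkernel_normalized:
  assumes w: "w \<in> ball 0 1"
  shows "hcoeff (hkernel_normalized w) n = of_real (sqrt (1 - (cmod w)\<^sup>2)) * cnj w ^ n"
proof -
  have "(cmod w)\<^sup>2 < 1" using w by (simp add: power_less_one_iff)
  have "hinner (hkernel w) (hkernel w) = 1 / (1 - cnj w * w)"
    using w by (simp add: hkernel_reproducing hfun_hkernel)
  also have "cnj w * w = of_real ((cmod w)\<^sup>2)"
    using complex_norm_square[of w] by (simp add: mult.commute)
  also have "1 / (1 - complex_of_real ((cmod w)\<^sup>2)) = of_real (1 / (1 - (cmod w)\<^sup>2))"
    by simp
  finally have "norm (hkernel w) = sqrt (1 / (1 - (cmod w)\<^sup>2))"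
    unfolding norm_hardy2_def inner_hardy2_def by simp
  then have "1 / norm (hkernel w) = sqrt (1 - (cmod w)\<^sup>2)"
    by (simp add: real_sqrt_divide)
  then show ?thesis
    unfolding hkernel_normalized_def
    by (simp add: scaleR_hardy2_def hcoeff_hscale hcoeff_hkernel[OF w])
qed

lemma hinner_diag_op_hkernel_normalized:
  assumes bdd: "bounded (range \<alpha>)" and w: "w1 \<in> ball 0 1" "w2 \<in> ball 0 1"
  shows "hinner (diag_op \<alpha> (hkernel_normalized w1)) (hkernel_normalized w2) =
    of_real (sqrt ((1 - (cmod w1)\<^sup>2) * (1 - (cmod w2)\<^sup>2))) * (\<Sum>n. \<alpha> n * (cnj w1 * w2) ^ n)"
proof -
  obtain B where B: "\<And>n. cmod (\<alpha> n) \<le> B" using bdd by (auto simp: bounded_iff)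
  have "cmod (cnj w1 * w2) < 1"
    using w mult_strict_mono'[of "cmod w1" 1 "cmod w2" 1] by (simp add: norm_mult)
  from summable_bounded_coeffs(1)[OF B this]
  have s: "summable (\<lambda>n. \<alpha> n * (cnj w1 * w2) ^ n)" .
  show ?thesis
    unfolding suminf_mult[OF s, symmetric] hinner_def
    by (rule suminf_cong)
      (simp add: hcoeff_diag_op[OF bdd] hcoeff_hkernel_normalized[OF w(1)]
        hcoeff_hkernel_normalized[OF w(2)] real_sqrt_mult power_mult_distrib)
qed

text \<open>The identity is the diagonal operator with constant symbol \<open>1\<close>, so this is
  the preceding formula with a geometric series.\<close>

lemma hinner_hkernel_normalized:
  assumes w: "w1 \<in> ball 0 1" "w2 \<in> ball 0 1"
  shows "hinner (hkernel_normalized w1) (hkernel_normalized w2) =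
    of_real (sqrt ((1 - (cmod w1)\<^sup>2) * (1 - (cmod w2)\<^sup>2))) / (1 - cnj w1 * w2)"
proof -
  have "cmod (cnj w1 * w2) < 1"
    using w mult_strict_mono'[of "cmod w1" 1 "cmod w2" 1] by (simp add: norm_mult)
  from suminf_geometric[OF this]
  have s: "(\<Sum>n. 1 * (cnj w1 * w2) ^ n) = 1 / (1 - cnj w1 * w2)" by simp
  have b: "bounded (range (\<lambda>_::nat. 1::complex))" by simp
  have "diag_op (\<lambda>_. 1) f = f" for f
    by (rule hardy2_eqI) (simp add: hcoeff_diag_op[OF b])
  with hinner_diag_op_hkernel_normalized[OF b w] s show ?thesis by simp
qed

lemma Berezin_range_diag_op:
  assumes q: "0 < q" "q \<le> 1" and bdd: "bounded (range \<alpha>)"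
  shows "Berezin_range q (diag_op \<alpha>) =
    (\<lambda>t. symbol_curve q \<alpha> (of_real t)) ` {- ((1 - q) / (1 + q))..<1}" (is "_ = ?C ` ?I")
proof (intro set_eqI iffI)
  fix v assume "v \<in> Berezin_range q (diag_op \<alpha>)"
  then obtain w1 w2 where v: "v = hinner (diag_op \<alpha> (hkernel_normalized w1)) (hkernel_normalized w2)"
    and w: "w1 \<in> ball 0 1" "w2 \<in> ball 0 1"
    and eq: "hinner (hkernel_normalized w1) (hkernel_normalized w2) = of_real q"
    unfolding Berezin_range_def by blast
  define s where "s = sqrt ((1 - (cmod w1)\<^sup>2) * (1 - (cmod w2)\<^sup>2))"
  \<comment> \<open>Solves \<open>s = q * (1 - t)\<close>. Since \<open>s\<close> and
    \<open>q\<close> are real, the condition on the kernels forces \<open>cnj w1 * w2\<close> to be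
    this real number.\<close>
  define t where "t = 1 - s / q"
  have lt: "cmod (cnj w1 * w2) < 1"
    using w mult_strict_mono'[of "cmod w1" 1 "cmod w2" 1] by (simp add: norm_mult)
  then have "cnj w1 * w2 \<noteq> 1" by (metis norm_one less_irrefl)
  then have "of_real s = of_real q * (1 - cnj w1 * w2)"
    using eq by (simp add: hinner_hkernel_normalized[OF w] s_def field_simps)
  then have z: "cnj w1 * w2 = of_real t"
    using q by (simp add: t_def field_simps)
  have s: "s = q * (1 - t)" using q by (simp add: t_def)
  have "(cmod w1)\<^sup>2 < 1" "(cmod w2)\<^sup>2 < 1"
    using w by (simp_all add: power_less_one_iff)
  then have "(1 - (cmod w1)\<^sup>2) * (1 - (cmod w2)\<^sup>2) = (q * (1 - t))\<^sup>2"
    unfolding s[symmetric] by (simp add: s_def)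
  moreover have "cmod w1 * cmod w2 = \<bar>t\<bar>"
    using arg_cong[OF z, of cmod] by (simp add: norm_mult)
  ultimately have "t \<in> ?I"
    using Berezin_parameter_bound[of "cmod w1" "cmod w2" t q] w
    unfolding Berezin_parameter_iff[OF q] by simp
  moreover have "v = ?C t"
    unfolding v hinner_diag_op_hkernel_normalized[OF bdd w] z s_def[symmetric] s symbol_curve_def
    by simp
  ultimately show "v \<in> ?C ` ?I" by blast
next
  fix v assume "v \<in> ?C ` ?I"
  then obtain t where v: "v = ?C t" and "t \<in> ?I" by blast
  then have t: "\<bar>t\<bar> < 1" "q * (1 - t) \<le> 1 - \<bar>t\<bar>" by (simp_all only: Berezin_parameter_iff[OF q])
  obtain x y where xy: "x * y = t" "\<bar>x\<bar> < 1" "\<bar>y\<bar> < 1" and p: "(1 - x\<^sup>2) * (1 - y\<^sup>2) = (q * (1 - t))\<^sup>2"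
    by (rule Berezin_parameter_existence[OF q(1) t])
  define w1 w2 where "w1 = complex_of_real x" and "w2 = complex_of_real y"
  have w: "w1 \<in> ball 0 1" "w2 \<in> ball 0 1" using xy by (simp_all add: w1_def w2_def)
  have z: "cnj w1 * w2 = of_real t" by (simp add: w1_def w2_def flip: xy(1))
  have s: "sqrt ((1 - (cmod w1)\<^sup>2) * (1 - (cmod w2)\<^sup>2)) = q * (1 - t)"
    using p q t by (simp add: w1_def w2_def)
  have "1 - complex_of_real t \<noteq> 0" using t(1) by auto
  then have "hinner (hkernel_normalized w1) (hkernel_normalized w2) = of_real q"
    unfolding hinner_hkernel_normalized[OF w] z s by simp
  moreover have "v = hinner (diag_op \<alpha> (hkernel_normalized w1)) (hkernel_normalized w2)"
    unfolding v hinner_diag_op_hkernel_normalized[OF bdd w] z s symbol_curve_def by simp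
  ultimately show "v \<in> Berezin_range q (diag_op \<alpha>)"
    unfolding Berezin_range_def using w by blast
qed

section \<open>Regularity of the curve and the lines containing it\<close>

text \<open>\<open>symbol_curve\<close> takes a complex argument so that differentiability along the
  real axis comes from holomorphy on the disc.\<close>

lemma symbol_curve_differentiable:
  assumes bdd: "bounded (range \<alpha>)"
  shows "(\<lambda>t. symbol_curve q \<alpha> (complex_of_real t)) differentiable_on {-1<..<1}"
proof -
  obtain B where B: "\<And>n. cmod (\<alpha> n) \<le> B" using bdd by (auto simp: bounded_iff)
  have "(\<lambda>z. \<Sum>n. \<alpha> n * z ^ n) holomorphic_on ball 0 1"
    by (rule power_series_holomorphic[where a = \<alpha>])
      (use summable_bounded_coeffs(1)[of \<alpha>, OF B] in \<open>auto intro: summable_sums\<close>)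
  then have h: "symbol_curve q \<alpha> holomorphic_on ball 0 1"
    unfolding symbol_curve_def[abs_def] by (intro holomorphic_intros)
  show ?thesis
    unfolding differentiable_on_def
  proof
    fix t :: real assume "t \<in> {-1<..<1}"
    then have "complex_of_real t \<in> ball 0 1" by auto
    from holomorphic_derivI[OF h _ this]
    have "(symbol_curve q \<alpha> has_field_derivative deriv (symbol_curve q \<alpha>) (of_real t)) (at (of_real t))"
      by simp
    from has_vector_derivative_real_field[OF this]
    show "(\<lambda>t. symbol_curve q \<alpha> (of_real t)) differentiable at t within {-1<..<1}"
      by (rule differentiableI_vector)
  qed
qed

text \<open>The weights \<open>(1 - t) * t ^ n\<close> sum to \<open>1\<close>, so subtracting
  \<open>b\<close> from every coefficient shifts the functional on the curve by
  \<open>q * b\<close>.\<close>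

lemma inner_symbol_curve:
  fixes t :: real
  assumes bdd: "bounded (range \<alpha>)" and t: "\<bar>t\<bar> < 1"
  shows "summable (\<lambda>n. (a \<bullet> \<alpha> n - b) * t ^ n)"
    and "a \<bullet> symbol_curve q \<alpha> (of_real t) - q * b = q * (1 - t) * (\<Sum>n. (a \<bullet> \<alpha> n - b) * t ^ n)"
proof -
  obtain B where B: "\<And>n. cmod (\<alpha> n) \<le> B" using bdd by (auto simp: bounded_iff)
  let ?S = "\<Sum>n. \<alpha> n * of_real t ^ n"
  have "(\<lambda>n. \<alpha> n * of_real t ^ n) sums ?S"
    using t by (intro summable_sums summable_bounded_coeffs(1)[OF B]) auto
  then have "(\<lambda>n. a \<bullet> (\<alpha> n * of_real t ^ n)) sums (a \<bullet> ?S)"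
    by (rule bounded_linear.sums[OF bounded_linear_inner_right])
  moreover have "a \<bullet> (\<alpha> n * of_real t ^ n) = a \<bullet> \<alpha> n * t ^ n" for n
    by (simp add: inner_complex_def algebra_simps flip: of_real_power)
  ultimately have "(\<lambda>n. a \<bullet> \<alpha> n * t ^ n) sums (a \<bullet> ?S)" by simp
  moreover have "(\<lambda>n. b * t ^ n) sums (b * (1 / (1 - t)))"
    using t by (intro sums_mult geometric_sums) auto
  ultimately have *: "(\<lambda>n. (a \<bullet> \<alpha> n - b) * t ^ n) sums (a \<bullet> ?S - b * (1 / (1 - t)))"
    unfolding left_diff_distrib by (rule sums_diff)
  then show "summable (\<lambda>n. (a \<bullet> \<alpha> n - b) * t ^ n)" by (rule sums_summable)
  have "symbol_curve q \<alpha> (of_real t) = (q * (1 - t)) *\<^sub>R ?S"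
    by (simp add: symbol_curve_def scaleR_conv_of_real)
  then have "a \<bullet> symbol_curve q \<alpha> (of_real t) = q * (1 - t) * (a \<bullet> ?S)" by simp
  moreover have "q * b = q * (1 - t) * (b * (1 / (1 - t)))" using t by simp
  ultimately show "a \<bullet> symbol_curve q \<alpha> (of_real t) - q * b = q * (1 - t) * (\<Sum>n. (a \<bullet> \<alpha> n - b) * t ^ n)"
    unfolding sums_unique[OF *, symmetric] by (simp only: right_diff_distrib)
qed

text \<open>The two lines share the normal \<open>a\<close>, and their offsets differ by the factor
  \<open>q\<close>. Containing \<open>{0..<1}\<close> gives uniqueness of coefficients; staying
  inside \<open>{-1<..<1}\<close> gives convergence.\<close>

lemma symbol_curve_in_line_iff:
  assumes q: "0 < q" and bdd: "bounded (range \<alpha>)" and I: "{0..<1} \<subseteq> I" "I \<subseteq> {-1<..<1}"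
  shows "(\<lambda>t. symbol_curve q \<alpha> (of_real t)) ` I \<subseteq> {x. a \<bullet> x = q * b} \<longleftrightarrow> range \<alpha> \<subseteq> {x. a \<bullet> x = b}"
proof
  assume L: "(\<lambda>t. symbol_curve q \<alpha> (of_real t)) ` I \<subseteq> {x. a \<bullet> x = q * b}"
  have "a \<bullet> \<alpha> m - b = 0" for m
  proof (rule real_power_series_eq_zero)
    show "summable (\<lambda>n. (a \<bullet> \<alpha> n - b) * x ^ n)" if "\<bar>x\<bar> < 1" for x
      by (rule inner_symbol_curve(1)[OF bdd that])
    show "(\<Sum>n. (a \<bullet> \<alpha> n - b) * x ^ n) = 0" if "0 \<le> x" "x < 1" for x
    proof -
      have "x \<in> I" using that I by auto
      then have "a \<bullet> symbol_curve q \<alpha> (of_real x) = q * b" using L by auto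
      then show ?thesis using inner_symbol_curve(2)[OF bdd, of x a q b] that q by simp
    qed
  qed
  then show "range \<alpha> \<subseteq> {x. a \<bullet> x = b}" by auto
next
  assume "range \<alpha> \<subseteq> {x. a \<bullet> x = b}"
  then have "a \<bullet> \<alpha> n = b" for n by auto
  then have "a \<bullet> symbol_curve q \<alpha> (of_real t) = q * b" if "t \<in> I" for t
    using inner_symbol_curve(2)[OF bdd, of t a q b] that I by fastforce
  then show "(\<lambda>t. symbol_curve q \<alpha> (of_real t)) ` I \<subseteq> {x. a \<bullet> x = q * b}" by auto
qed

text \<open>The series is at most \<open>B / (1 - \<bar>t\<bar>)\<close> in modulus, and
  admissibility of \<open>t\<close> bounds the prefactor \<open>q * (1 - t)\<close> by exactly
  \<open>1 - \<bar>t\<bar>\<close>.\<close>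

lemma bounded_symbol_curve:
  assumes q: "0 < q" "q \<le> 1" and bdd: "bounded (range \<alpha>)"
  shows "bounded ((\<lambda>t. symbol_curve q \<alpha> (of_real t)) ` {- ((1 - q) / (1 + q))..<1})"
proof -
  obtain B where B: "\<And>n. cmod (\<alpha> n) \<le> B" using bdd by (auto simp: bounded_iff)
  have B0: "0 \<le> B" using B[of 0] norm_ge_zero order_trans by blast
  have "cmod (symbol_curve q \<alpha> (of_real t)) \<le> B"
    if t: "\<bar>t\<bar> < 1" "q * (1 - t) \<le> 1 - \<bar>t\<bar>" for t
  proof -
    have "q * (1 - t) * (B / (1 - \<bar>t\<bar>)) \<le> (1 - \<bar>t\<bar>) * (B / (1 - \<bar>t\<bar>))"
      using B0 t by (intro mult_right_mono) auto
    moreover have "cmod (symbol_curve q \<alpha> (of_real t)) = q * (1 - t) * cmod (\<Sum>n. \<alpha> n * of_real t ^ n)"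
    proof -
      have "symbol_curve q \<alpha> (of_real t) = (q * (1 - t)) *\<^sub>R (\<Sum>n. \<alpha> n * of_real t ^ n)"
        by (simp add: symbol_curve_def scaleR_conv_of_real)
      then show ?thesis using q t(1) by simp
    qed
    moreover have "\<dots> \<le> q * (1 - t) * (B / (1 - \<bar>t\<bar>))"
      using summable_bounded_coeffs(2)[OF B, where z = "of_real t"] q t(1) by (intro mult_left_mono) auto
    ultimately show ?thesis using t(1) by simp
  qed
  then show ?thesis
    unfolding bounded_iff using Berezin_parameter_iff[OF q] by blast
qed

theorem theorem3p1:
  fixes q :: real and \<alpha> :: "nat \<Rightarrow> complex"
  assumes "0 < q" and "q \<le> 1"
    and "bounded (range \<alpha>)"
  shows "(convex (Berezin_range q (diag_op \<alpha>)) \<longleftrightarrow> line_segment (Berezin_range q (diag_op \<alpha>))) \<and>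
         (line_segment (Berezin_range q (diag_op \<alpha>)) \<longleftrightarrow> collinear (range \<alpha>))"
proof -
  define I where "I = {- ((1 - q) / (1 + q))..<1}"
  define C where "C = (\<lambda>t. symbol_curve q \<alpha> (complex_of_real t))"
  have R: "Berezin_range q (diag_op \<alpha>) = C ` I"
    unfolding I_def C_def using assms by (rule Berezin_range_diag_op)
  have I: "{0..<1} \<subseteq> I" "I \<subseteq> {-1<..<1}"
  proof -
    show "{0..<1} \<subseteq> I"
    proof
      fix t :: real assume "t \<in> {0..<1}"
      then show "t \<in> I"
        unfolding I_def Berezin_parameter_iff[OF assms(1,2)]
        using mult_right_mono[OF assms(2), of "1 - t"] by simp
    qed
    show "I \<subseteq> {-1<..<1}"
    proof
      fix t assume "t \<in> I"
      then have "\<bar>t\<bar> < 1"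
        unfolding I_def Berezin_parameter_iff[OF assms(1,2)] by blast
      then show "t \<in> {-1<..<1}" by auto
    qed
  qed
  have diff: "C differentiable_on I"
    unfolding C_def by (rule differentiable_on_subset[OF symbol_curve_differentiable[OF assms(3)] I(2)])
  have "connected (C ` I)"
    by (intro connected_continuous_image differentiable_imp_continuous_on diff) (simp add: I_def)
  moreover have "bounded (C ` I)"
    unfolding I_def C_def using assms by (rule bounded_symbol_curve)
  moreover have "C ` I \<noteq> {}" using I by auto
  \<comment> \<open>For a collinear set, connectedness and convexity coincide.\<close>
  ultimately have seg: "line_segment (C ` I) \<longleftrightarrow> collinear (C ` I)"
    by (auto simp: line_segment_def convex_connected_collinear)
  have "(\<exists>b. C ` I \<subseteq> {x. a \<bullet> x = b}) \<longleftrightarrow> (\<exists>b. range \<alpha> \<subseteq> {x. a \<bullet> x = b})" for a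
  proof -
    have "C ` I \<subseteq> {x. a \<bullet> x = q * b} \<longleftrightarrow> range \<alpha> \<subseteq> {x. a \<bullet> x = b}" for b
      unfolding C_def by (rule symbol_curve_in_line_iff[OF assms(1,3) I])
    \<comment> \<open>Every offset has the form \<open>q * b\<close>, so the quantifier over offsets
      absorbs the factor.\<close>
    moreover have "b = q * (b / q)" for b using assms(1) by simp
    ultimately show ?thesis by metis
  qed
  then have col: "collinear (C ` I) \<longleftrightarrow> collinear (range \<alpha>)"
    by (simp only: complex_collinear_iff ex_simps)
  have "line_segment (C ` I) \<Longrightarrow> convex (C ` I)" by (simp add: line_segment_def)
  then show ?thesis
    unfolding R using seg col convex_differentiable_curve_collinear[OF diff] by blast
qed

end
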